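(* Let $C,D\ge 1$. Let $E$ be a Banach space and let $M$ be a finite metric space which is $C$-embeddable in $E$. Let $\mathcal{N}=\{N_x\}_{x\in M}$ be a family of finite metric spaces each of which is $D$-embeddable in $E$. Let $\beta>2(C+1)$. Then the $\beta$-composition $M_\beta[\mathcal{N}]$ is $A$-embeddable in $E$, where $$A=\max\left(D,\; C+\frac{2C(C+1)}{\beta-2(C+1)}\right).$$ In particular, if $\varepsilon>0$, $D\le C$, and $\beta>2\left(\frac{C+\varepsilon}{\varepsilon}\right)(C+1)$, then $M_\beta[\mathcal{N}]$ is $(C+\varepsilon)$-embeddable in $E$.
   Context: The distortion of an injective map $f:X\to Y$ between metric spaces is $\sup_{x\ne y}\frac{d_Y(f(x),f(y))}{d_X(x,y)}\cdot\sup_{x\ne y}\frac{d_X(x,y)}{d_Y(f(x),f(y))}$. A metric space $X$ is $K$-embeddable into $Y$ if there is an injective map $X\to Y$ of distortion at most $K$. Metric composition: let $M$ be a finite metric space, $\mathcal{N}=\{N_x\}_{x\in M}$ a collection of disjoint finite metric spaces indexed by the points of $M$, and $\beta\ge 1/2$. The $\beta$-composition $M_\beta[\mathcal{N}]$ is the disjoint union of the sets $N_x$, $x\in M$, with the following distance $d_\beta$: for $u\in N_x$, $v\in N_y$, $d_\beta(u,v)=d_{N_x}(u,v)$ if $x=y$, and $d_\beta(u,v)=\beta\gamma\, d_M(x,y)$ if $x\neq y$, where $\gamma=\frac{\max_{z\in M}\operatorname{diam}(N_z)}{\min_{x\ne y\in M}d_M(x,y)}$. The composition is understood only for data for which this is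 a metric, i.e. $\gamma>0$ (at least one $N_x$ has more than one point); if $M$ has a single point $x$, then $M_\beta[\mathcal{N}]$ is $N_x$. *)

theory Defs
  imports "HOL-Analysis.Analysis"
begin

text \<open>The suprema are taken in \<^typ>\<open>ennreal\<close>, so that they always exist: the distortion is
  \<open>\<infinity>\<close> if one of the suprema is infinite, and \<open>0\<close> if the domain has at most one point.\<close>

definition distortion :: "'a metric \<Rightarrow> 'b metric \<Rightarrow> ('a \<Rightarrow> 'b) \<Rightarrow> ennreal" where
  "distortion X Y f =
     (SUP (x, y) \<in> {(x, y). x \<in> mspace X \<and> y \<in> mspace X \<and> x \<noteq> y}.
        ennreal (mdist Y (f x) (f y) / mdist X x y)) *
     (SUP (x, y) \<in> {(x, y). x \<in> mspace X \<and> y \<in> mspace X \<and> x \<noteq> y}.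
        ennreal (mdist X x y / mdist Y (f x) (f y)))"

definition embeddable :: "real \<Rightarrow> 'a metric \<Rightarrow> 'b metric \<Rightarrow> bool" where
  "embeddable K X Y \<longleftrightarrow>
     (\<exists>f \<in> mspace X \<rightarrow> mspace Y. inj_on f (mspace X) \<and> distortion X Y f \<le> ennreal K)"

definition mdiameter :: "'a metric \<Rightarrow> real" where
  "mdiameter X =
     (if mspace X = {} then 0 else SUP (u, v) \<in> mspace X \<times> mspace X. mdist X u v)"

definition comp_gamma :: "'a metric \<Rightarrow> ('a \<Rightarrow> 'b metric) \<Rightarrow> real" where
  "comp_gamma M N =
     (MAX z \<in> mspace M. mdiameter (N z)) /
     Min {mdist M x y | x y. x \<in> mspace M \<and> y \<in> mspace M \<and> x \<noteq> y}"

definition comp_space :: "'a metric \<Rightarrow> ('a \<Rightarrow> 'b metric) \<Rightarrow> 'b set" where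
  "comp_space M N = (\<Union>x \<in> mspace M. mspace (N x))"

text \<open>For disjoint spaces \<open>N x\<close>, the unique \<open>x\<close> in \<open>M\<close> with \<open>u \<in> N x\<close>.\<close>

definition comp_index :: "'a metric \<Rightarrow> ('a \<Rightarrow> 'b metric) \<Rightarrow> 'b \<Rightarrow> 'a" where
  "comp_index M N u = (THE x. x \<in> mspace M \<and> u \<in> mspace (N x))"

text \<open>The value \<open>0\<close> off the underlying set is immaterial; it is there because
  \<^locale>\<open>Metric_space\<close> requires symmetry and nonnegativity on the whole type.\<close>

definition comp_dist :: "real \<Rightarrow> 'a metric \<Rightarrow> ('a \<Rightarrow> 'b metric) \<Rightarrow> 'b \<Rightarrow> 'b \<Rightarrow> real" where
  "comp_dist \<beta> M N u v =
     (if u \<in> comp_space M N \<and> v \<in> comp_space M N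
      then let x = comp_index M N u; y = comp_index M N v
           in if x = y then mdist (N x) u v else \<beta> * comp_gamma M N * mdist M x y
      else 0)"

definition composition :: "real \<Rightarrow> 'a metric \<Rightarrow> ('a \<Rightarrow> 'b metric) \<Rightarrow> 'b metric" where
  "composition \<beta> M N = metric (comp_space M N, comp_dist \<beta> M N)"

text \<open>The data for which the composition is defined. If \<open>M\<close> has at most one point, then
  \<^const>\<open>comp_gamma\<close> is an unspecified number (a minimum over the empty set), but it does not enter
  the distance.\<close>

definition composable :: "'a metric \<Rightarrow> ('a \<Rightarrow> 'b metric) \<Rightarrow> bool" where
  "composable M N \<longleftrightarrow>
     finite (mspace M) \<and> (\<forall>x \<in> mspace M. finite (mspace (N x))) \<and>
     disjoint_family_on (\<lambda>x. mspace (N x)) (mspace M) \<and>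
     (card (mspace M) > 1 \<longrightarrow> comp_gamma M N > 0)"

lemma mdist_pos:
  assumes "x \<in> mspace X" "y \<in> mspace X" "x \<noteq> y"
  shows "mdist X x y > 0"
  using assms mdist_nonneg[of X x y] mdist_zero[of x X y] by linarith

lemma comp_index_eq:
  assumes "composable M N" "x \<in> mspace M" "u \<in> mspace (N x)"
  shows "comp_index M N u = x"
  using assms unfolding comp_index_def composable_def disjoint_family_on_def
  by (intro the_equality) blast+

lemma mdist_le_mdiameter:
  assumes "finite (mspace X)" "u \<in> mspace X" "v \<in> mspace X"
  shows "mdist X u v \<le> mdiameter X"
proof -
  have "mdist X u v \<le> (SUP (u, v) \<in> mspace X \<times> mspace X. mdist X u v)"
    using assms by (intro cSUP_upper2[of _ _ "(u, v)"] bdd_above_finite) auto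
  then show ?thesis using assms by (auto simp: mdiameter_def)
qed

lemma mdiameter_le_gamma:
  assumes "composable M N" "x \<in> mspace M" "y \<in> mspace M" "x \<noteq> y" "z \<in> mspace M"
  shows "mdiameter (N z) \<le> comp_gamma M N * mdist M x y" and "comp_gamma M N > 0"
proof -
  have fin: "finite (mspace M)" using assms by (simp add: composable_def)
  have "card {x, y} \<le> card (mspace M)" using fin assms by (intro card_mono) auto
  then show pos: "comp_gamma M N > 0" using assms by (simp add: composable_def)
  define S where "S = {mdist M x y | x y. x \<in> mspace M \<and> y \<in> mspace M \<and> x \<noteq> y}"
  have "S \<subseteq> (\<lambda>(x, y). mdist M x y) ` (mspace M \<times> mspace M)" by (auto simp: S_def)
  then have finS: "finite S" using fin finite_subset by fastforce
  have xy: "mdist M x y \<in> S" using assms by (auto simp: S_def)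
  have Spos: "Min S > 0" using finS xy by (subst Min_gr_iff) (auto simp: S_def intro: mdist_pos)
  have le: "Min S \<le> mdist M x y" using finS xy by simp
  have "mdiameter (N z) \<le> (MAX z \<in> mspace M. mdiameter (N z))"
    using fin assms by (intro Max_ge) auto
  also have "\<dots> = comp_gamma M N * Min S"
    using Spos by (simp add: comp_gamma_def S_def[symmetric])
  also have "\<dots> \<le> comp_gamma M N * mdist M x y" using pos le by simp
  finally show "mdiameter (N z) \<le> comp_gamma M N * mdist M x y" .
qed

lemma comp_dist_eq:
  assumes "composable M N" "x \<in> mspace M" "y \<in> mspace M" "u \<in> mspace (N x)" "v \<in> mspace (N y)"
  shows "comp_dist \<beta> M N u v =
           (if x = y then mdist (N x) u v else \<beta> * comp_gamma M N * mdist M x y)"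
  using assms comp_index_eq[of M N x u] comp_index_eq[of M N y v]
  by (auto simp: comp_dist_def comp_space_def Let_def)

lemma Metric_space_comp:
  assumes comp: "composable M N" and \<beta>: "\<beta> \<ge> 1/2"
  shows "Metric_space (comp_space M N) (comp_dist \<beta> M N)"
proof
  fix u v
  let ?S = "comp_space M N"
  have key: "0 \<le> comp_dist \<beta> M N u v \<and> comp_dist \<beta> M N u v = comp_dist \<beta> M N v u \<and>
    (comp_dist \<beta> M N u v = 0 \<longleftrightarrow> u = v)" if uv: "u \<in> ?S" "v \<in> ?S" for u v
  proof -
    obtain x y where xy: "x \<in> mspace M" "y \<in> mspace M" "u \<in> mspace (N x)" "v \<in> mspace (N y)"
      using uv by (auto simp: comp_space_def)
    show ?thesis
    proof (cases "x = y")
      case True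
      then show ?thesis using xy comp comp_dist_eq[of M N x y u v] comp_dist_eq[of M N y x v u]
        by (auto simp: mdist_commute)
    next
      case False
      then have "u \<noteq> v" using xy comp comp_index_eq by metis
      moreover have "\<beta> * comp_gamma M N * mdist M x y > 0"
        using mdiameter_le_gamma(2)[OF comp xy(1,2) False xy(1)] \<beta> False xy mdist_pos[of x M y] by simp
      ultimately show ?thesis
        using False xy comp comp_dist_eq[of M N x y u v] comp_dist_eq[of M N y x v u]
        by (auto simp: mdist_commute)
    qed
  qed
  show "0 \<le> comp_dist \<beta> M N u v" "comp_dist \<beta> M N u v = comp_dist \<beta> M N v u"
    using key[of u v] by (auto simp: comp_dist_def)
  show "comp_dist \<beta> M N u v = 0 \<longleftrightarrow> u = v" if "u \<in> ?S" "v \<in> ?S"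
    using key that by blast
  fix w
  assume "u \<in> ?S" "v \<in> ?S" "w \<in> ?S"
  then obtain x y z where xyz: "x \<in> mspace M" "y \<in> mspace M" "z \<in> mspace M"
      "u \<in> mspace (N x)" "v \<in> mspace (N y)" "w \<in> mspace (N z)"
    by (auto simp: comp_space_def)
  note eqs = comp_dist_eq[OF comp xyz(1,2,4,5)] comp_dist_eq[OF comp xyz(2,3,5,6)]
    comp_dist_eq[OF comp xyz(1,3,4,6)]
  define g where "g = \<beta> * comp_gamma M N"
  show "comp_dist \<beta> M N u w \<le> comp_dist \<beta> M N u v + comp_dist \<beta> M N v w"
  proof (cases "x = y \<and> y = z")
    case True
    then show ?thesis using xyz eqs by (simp add: mdist_triangle)
  next
    case False
    then have gpos: "comp_gamma M N > 0" using mdiameter_le_gamma(2)[OF comp] xyz by metis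
    then have g: "g > 0" using \<beta> by (simp add: g_def)
    have *: "mdist (N x) u w \<le> 2 * (g * mdist M x y)" if "x = z" "x \<noteq> y"
    proof -
      have "mdist (N x) u w \<le> mdiameter (N x)"
        using xyz that comp by (intro mdist_le_mdiameter) (auto simp: composable_def)
      also have "\<dots> \<le> comp_gamma M N * mdist M x y"
        using mdiameter_le_gamma(1)[OF comp] xyz that by metis
      also have "\<dots> \<le> (2 * \<beta>) * (comp_gamma M N * mdist M x y)"
        using \<beta> gpos mult_right_mono[of 1 "2 * \<beta>" "comp_gamma M N * mdist M x y"] by simp
      finally show ?thesis by (simp add: g_def mult.assoc)
    qed
    have tri: "g * mdist M x z \<le> g * mdist M x y + g * mdist M y z"
      using g mdist_triangle[of x M y z] xyz
      by (metis distrib_left mult_left_mono less_imp_le)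
    show ?thesis
    proof (cases "x = z")
      case True
      then show ?thesis using False eqs * by (simp add: g_def[symmetric] mdist_commute)
    next
      case neq: False
      show ?thesis using neq eqs tri by (auto simp: g_def[symmetric])
    qed
  qed
qed

lemma
  assumes "composable M N" "\<beta> \<ge> 1/2"
  shows mspace_composition: "mspace (composition \<beta> M N) = comp_space M N"
    and mdist_composition: "mdist (composition \<beta> M N) = comp_dist \<beta> M N"
  using Metric_space_comp[OF assms]
  by (simp_all add: composition_def Metric_space.mspace_metric Metric_space.mdist_metric)

end

theory Submission
  imports Defs
begin

text \<open>Let \<open>\<phi>\<close> embed \<open>M\<close> in \<open>E\<close> with \<open>d \<le> \<parallel>\<phi> x - \<phi> y\<parallel> \<le> C d\<close>; scaling a map of distortion at most
  \<open>C\<close> brings it into this form (\<open>embeddable_normed_bounds\<close>). Likewise let \<open>\<psi> x\<close> embed \<open>N x\<close> with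
  \<open>(s / D) d \<le> \<parallel>\<psi> x u - \<psi> x v\<parallel> \<le> s d\<close>, where the scale \<open>s > 0\<close> is still free, and translate
  it so that some base point of \<open>N x\<close> goes to \<open>0\<close>. Put a copy of \<open>N x\<close> at each point of the
  dilated image of \<open>M\<close>: \<open>f u = \<beta> \<gamma> \<phi> x + \<psi> x u\<close> for \<open>u \<in> N x\<close>.

  Between two points of the same \<open>N x\<close> the map \<open>f\<close> stretches by a factor in \<open>[s / D, s]\<close>.
  For \<open>u \<in> N x\<close> and \<open>v \<in> N y\<close> with \<open>x \<noteq> y\<close>, their distance in the composition is
  \<open>\<beta> \<gamma> d(x, y)\<close>, whereas \<open>\<psi> x u\<close> and \<open>\<psi> y v\<close> have norm at most
  \<open>s\<close> times a diameter, hence at most \<open>s \<gamma> d(x, y)\<close> by the choice of \<open>\<gamma>\<close>. So there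
  \<open>f\<close> stretches by a factor in \<open>[1 - 2 s / \<beta>, C + 2 s / \<beta>]\<close>. The scale \<open>s = C \<beta> / (\<beta> - 2)\<close> is
  the one at which the two upper bounds \<open>s\<close> and \<open>C + 2 s / \<beta>\<close> agree; the distortion is then at
  most the larger of \<open>s / (s / D) = D\<close> and
  \<open>s / (1 - 2 s / \<beta>) = C \<beta> / (\<beta> - 2 (C + 1)) = C + 2 C (C + 1) / (\<beta> - 2 (C + 1))\<close>.\<close>

lemma embeddable_mono:
  assumes "embeddable K X Y" "K \<le> K'"
  shows "embeddable K' X Y"
  using assms unfolding embeddable_def by (meson ennreal_leI order_trans)

lemma embeddableI_bounds:
  assumes f: "f \<in> mspace X \<rightarrow> mspace Y" and L: "L > 0" and U: "U \<le> K * L"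
    and lower: "\<And>x y. \<lbrakk>x \<in> mspace X; y \<in> mspace X; x \<noteq> y\<rbrakk> \<Longrightarrow> L * mdist X x y \<le> mdist Y (f x) (f y)"
    and upper: "\<And>x y. \<lbrakk>x \<in> mspace X; y \<in> mspace X; x \<noteq> y\<rbrakk> \<Longrightarrow> mdist Y (f x) (f y) \<le> U * mdist X x y"
  shows "embeddable K X Y"
proof -
  have pos: "mdist Y (f x) (f y) > 0" if "x \<in> mspace X" "y \<in> mspace X" "x \<noteq> y" for x y
    using lower[OF that] mdist_pos[OF that] L by (meson less_le_trans mult_pos_pos)
  have "inj_on f (mspace X)"
  proof (rule inj_onI, rule ccontr)
    fix x y assume "x \<in> mspace X" "y \<in> mspace X" "f x = f y" "x \<noteq> y"
    moreover from this have "mdist Y (f x) (f y) = 0" using f by (simp add: Pi_iff)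
    ultimately show False using pos[of x y] by simp
  qed
  moreover have "distortion X Y f \<le> ennreal U * ennreal (1 / L)"
    unfolding distortion_def
  proof (rule mult_mono)
    show "(SUP (x, y) \<in> {(x, y). x \<in> mspace X \<and> y \<in> mspace X \<and> x \<noteq> y}.
        ennreal (mdist Y (f x) (f y) / mdist X x y)) \<le> ennreal U"
      using upper mdist_pos[of _ X]
      by (auto intro!: SUP_least ennreal_leI simp: divide_le_eq)
    show "(SUP (x, y) \<in> {(x, y). x \<in> mspace X \<and> y \<in> mspace X \<and> x \<noteq> y}.
        ennreal (mdist X x y / mdist Y (f x) (f y))) \<le> ennreal (1 / L)"
      using lower pos L
      by (auto intro!: SUP_least ennreal_leI simp: divide_le_eq le_divide_eq mult.commute)
  qed auto
  moreover have "ennreal U * ennreal (1 / L) = ennreal (U / L)"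
    using L by (simp flip: ennreal_mult'')
  moreover have "ennreal (U / L) \<le> ennreal K"
    using L U by (auto intro!: ennreal_leI simp: divide_le_eq)
  ultimately show ?thesis using f unfolding embeddable_def by auto
qed

text \<open>The two suprema in the distortion are the optimal Lipschitz constants of the map and of its
  inverse. In a normed space, scaling the map trades one for the other, so the lower bound can be
  prescribed.\<close>

lemma embeddable_normed_bounds:
  fixes X :: "'a metric"
  assumes emb: "embeddable K X (euclidean_metric :: ('e::real_normed_vector) metric)"
    and K: "K \<ge> 0" and c: "c > 0"
  obtains g :: "'a \<Rightarrow> 'e::real_normed_vector" where
    "\<And>x y. \<lbrakk>x \<in> mspace X; y \<in> mspace X\<rbrakk> \<Longrightarrow> c * mdist X x y \<le> norm (g x - g y)"
    "\<And>x y. \<lbrakk>x \<in> mspace X; y \<in> mspace X\<rbrakk> \<Longrightarrow> norm (g x - g y) \<le> K * c * mdist X x y"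
proof -
  obtain f :: "'a \<Rightarrow> 'e" where inj: "inj_on f (mspace X)"
    and dist: "distortion X euclidean_metric f \<le> ennreal K"
    using emb unfolding embeddable_def by blast
  define P where "P = {(x, y). x \<in> mspace X \<and> y \<in> mspace X \<and> x \<noteq> y}"
  define a where "a = (SUP (x, y) \<in> P. ennreal (norm (f x - f y) / mdist X x y))"
  define b where "b = (SUP (x, y) \<in> P. ennreal (mdist X x y / norm (f x - f y)))"
  have ab: "a * b \<le> ennreal K"
    using dist by (simp add: distortion_def P_def a_def b_def dist_norm)
  have pos: "mdist X x y > 0" "norm (f x - f y) > 0" if "(x, y) \<in> P" for x y
    using that inj mdist_pos[of x X y] by (auto simp: P_def inj_on_def)
  have a_ge: "ennreal (norm (f x - f y) / mdist X x y) \<le> a" if "(x, y) \<in> P" for x y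
    unfolding a_def using that by (rule SUP_upper2) simp
  have b_ge: "ennreal (mdist X x y / norm (f x - f y)) \<le> b" if "(x, y) \<in> P" for x y
    unfolding b_def using that by (rule SUP_upper2) simp
  define r where "r = c * enn2real b"
  have bounds: "c * mdist X x y \<le> norm (r *\<^sub>R f x - r *\<^sub>R f y) \<and>
      norm (r *\<^sub>R f x - r *\<^sub>R f y) \<le> K * c * mdist X x y"
    if xy: "x \<in> mspace X" "y \<in> mspace X" for x y
  proof (cases "x = y")
    case True
    then have "mdist X x y = 0" using xy by simp
    then show ?thesis using True by simp
  next
    case False
    then have P: "(x, y) \<in> P" using xy by (simp add: P_def)
    note pos' = pos[OF P]
    have "a \<noteq> 0" "b \<noteq> 0" using a_ge[OF P] b_ge[OF P] pos' by (auto simp: ennreal_eq_0_iff divide_le_eq)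
    \<comment> \<open>As neither factor vanishes, finiteness of the product makes both finite.\<close>
    moreover have "a * b < top" using ab by (simp add: le_less_trans)
    ultimately have "a < top" "b < top" by (auto simp: ennreal_mult_less_top)
    then obtain a' b' where a': "a = ennreal a'" "a' \<ge> 0" and b': "b = ennreal b'" "b' \<ge> 0"
      by (metis ennreal_cases less_irrefl)
    have 1: "norm (f x - f y) \<le> a' * mdist X x y"
      using a_ge[OF P] a' pos' by (simp add: divide_le_eq)
    have 2: "mdist X x y \<le> b' * norm (f x - f y)"
      using b_ge[OF P] b' pos' by (simp add: divide_le_eq)
    have 3: "a' * b' \<le> K" using ab a' b' K by (simp flip: ennreal_mult)
    have r: "r = c * b'" by (simp add: r_def b')
    have norm_eq: "norm (r *\<^sub>R f x - r *\<^sub>R f y) = c * (b' * norm (f x - f y))"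
      using c b' by (simp add: r flip: scaleR_diff_right)
    have "b' * norm (f x - f y) \<le> b' * (a' * mdist X x y)"
      using 1 b' by (intro mult_left_mono) auto
    also have "\<dots> \<le> K * mdist X x y"
      using mult_right_mono[OF 3, of "mdist X x y"] by (simp add: mult_ac)
    finally have "c * (b' * norm (f x - f y)) \<le> c * (K * mdist X x y)"
      using c by simp
    then show ?thesis using 2 c norm_eq by (simp add: mult_ac)
  qed
  show thesis by (rule that[of "\<lambda>x. r *\<^sub>R f x"]) (use bounds in blast)+
qed

text \<open>Used with \<open>a\<close> and \<open>b\<close> in the dilated image of \<open>M\<close>, and \<open>p\<close> and \<open>q\<close> in the translated images
  of the pieces that sit there.\<close>

lemma norm_perturbed_diff_bounds:
  fixes a b p q :: "'e::real_normed_vector"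
  assumes "norm p \<le> t" "norm q \<le> t"
  shows "norm (a - b) - 2 * t \<le> norm ((a + p) - (b + q))"
    and "norm ((a + p) - (b + q)) \<le> norm (a - b) + 2 * t"
proof -
  have eq: "(a + p) - (b + q) = (a - b) + (p - q)" by simp
  have pq: "norm (p - q) \<le> 2 * t" using assms norm_triangle_ineq4[of p q] by linarith
  show "norm (a - b) - 2 * t \<le> norm ((a + p) - (b + q))"
    unfolding eq using norm_diff_ineq[of "a - b" "p - q"] pq by linarith
  show "norm ((a + p) - (b + q)) \<le> norm (a - b) + 2 * t"
    unfolding eq using norm_triangle_ineq[of "a - b" "p - q"] pq by linarith
qed

lemma embeddable_composition:
  fixes C D \<beta> :: real
    and M :: "'a metric" and N :: "'a \<Rightarrow> 'b metric"
  assumes C: "C \<ge> 1" and D: "D \<ge> 1"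
    and comp: "composable M N"
    and M_emb: "embeddable C M (euclidean_metric :: ('e::real_normed_vector) metric)"
    and N_emb: "\<And>x. x \<in> mspace M \<Longrightarrow> embeddable D (N x) (euclidean_metric :: 'e metric)"
    and beta: "\<beta> > 2 * (C + 1)"
  shows "embeddable (max D (C + 2 * C * (C + 1) / (\<beta> - 2 * (C + 1))))
           (composition \<beta> M N) (euclidean_metric :: 'e metric)"
proof -
  define \<gamma> where "\<gamma> = comp_gamma M N"
  define s where "s = C * \<beta> / (\<beta> - 2)"
  define L where "L = min (s / D) (1 - 2 * s / \<beta>)"
  define A where "A = max D (C + 2 * C * (C + 1) / (\<beta> - 2 * (C + 1)))"
  have \<beta>: "\<beta> > 4" using beta C by simp
  have s: "s > 0" using C \<beta> by (simp add: s_def)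
  have s_eq: "C + 2 * s / \<beta> = s" using \<beta> by (simp add: s_def field_simps)
  have gap_eq: "1 - 2 * s / \<beta> = (\<beta> - 2 * (C + 1)) / (\<beta> - 2)"
    using \<beta> by (simp add: s_def field_simps)
  have gap: "1 - 2 * s / \<beta> > 0" unfolding gap_eq using \<beta> beta by simp
  have L: "L > 0" using s D gap by (simp add: L_def)
  have s_le: "s \<le> A * L"
  proof -
    have "s = D * (s / D)" using D by simp
    also have "\<dots> \<le> A * (s / D)" using s D by (intro mult_right_mono) (auto simp: A_def)
    finally have 1: "s \<le> A * (s / D)" .
    have "s = (C + 2 * C * (C + 1) / (\<beta> - 2 * (C + 1))) * (1 - 2 * s / \<beta>)"
      unfolding gap_eq using \<beta> beta by (simp add: s_def divide_simps) (simp add: algebra_simps)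
    also have "\<dots> \<le> A * (1 - 2 * s / \<beta>)" using gap by (intro mult_right_mono) (auto simp: A_def)
    finally show ?thesis using 1 by (simp add: L_def min_def)
  qed
  obtain \<phi> :: "'a \<Rightarrow> 'e" where
    \<phi>: "\<And>x y. \<lbrakk>x \<in> mspace M; y \<in> mspace M\<rbrakk> \<Longrightarrow> mdist M x y \<le> norm (\<phi> x - \<phi> y)"
       "\<And>x y. \<lbrakk>x \<in> mspace M; y \<in> mspace M\<rbrakk> \<Longrightarrow> norm (\<phi> x - \<phi> y) \<le> C * mdist M x y"
    using embeddable_normed_bounds[OF M_emb, of 1] C by auto
  have "\<exists>g :: 'b \<Rightarrow> 'e. \<forall>u \<in> mspace (N x). \<forall>v \<in> mspace (N x).
      s / D * mdist (N x) u v \<le> norm (g u - g v) \<and> norm (g u - g v) \<le> s * mdist (N x) u v"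
    if x: "x \<in> mspace M" for x
  proof -
    obtain g :: "'b \<Rightarrow> 'e" where
      "\<And>u v. \<lbrakk>u \<in> mspace (N x); v \<in> mspace (N x)\<rbrakk> \<Longrightarrow> s / D * mdist (N x) u v \<le> norm (g u - g v)"
      "\<And>u v. \<lbrakk>u \<in> mspace (N x); v \<in> mspace (N x)\<rbrakk> \<Longrightarrow>
        norm (g u - g v) \<le> D * (s / D) * mdist (N x) u v"
      using embeddable_normed_bounds[OF N_emb[OF x], of "s / D"] s D by auto
    moreover have "D * (s / D) = s" using D by simp
    ultimately show ?thesis by metis
  qed
  then obtain \<psi> :: "'a \<Rightarrow> 'b \<Rightarrow> 'e" where \<psi>:
    "\<And>x u v. \<lbrakk>x \<in> mspace M; u \<in> mspace (N x); v \<in> mspace (N x)\<rbrakk> \<Longrightarrow>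
      s / D * mdist (N x) u v \<le> norm (\<psi> x u - \<psi> x v) \<and>
      norm (\<psi> x u - \<psi> x v) \<le> s * mdist (N x) u v"
    by metis
  define p where "p x = (SOME u. u \<in> mspace (N x))" for x
  have p: "p x \<in> mspace (N x)" if "u \<in> mspace (N x)" for x u
    unfolding p_def using that by (rule someI)
  \<comment> \<open>For \<open>M\<close> with a single point \<open>\<gamma>\<close> is an unspecified number; \<open>F\<close> is then merely a translate of
    \<open>\<psi> x\<close>. Elsewhere \<open>\<gamma>\<close> matters only between distinct \<open>x\<close> and \<open>y\<close>, where it is positive.\<close>
  define F where "F x u = (\<beta> * \<gamma>) *\<^sub>R \<phi> x + (\<psi> x u - \<psi> x (p x))" for x u
  define f where "f u = F (comp_index M N u) u" for u
  have "L * comp_dist \<beta> M N u v \<le> norm (f u - f v) \<and> norm (f u - f v) \<le> s * comp_dist \<beta> M N u v"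
    if uv: "u \<in> comp_space M N" "v \<in> comp_space M N" for u v
  proof -
    obtain x y where xy: "x \<in> mspace M" "y \<in> mspace M" "u \<in> mspace (N x)" "v \<in> mspace (N y)"
      using uv by (auto simp: comp_space_def)
    have f: "f u = F x u" "f v = F y v"
      using comp_index_eq[OF comp] xy by (auto simp: f_def)
    show ?thesis
    proof (cases "x = y")
      case True
      have "L * mdist (N x) u v \<le> s / D * mdist (N x) u v"
        by (intro mult_right_mono) (auto simp: L_def)
      then show ?thesis
        using True f xy \<psi>[of x u v] comp_dist_eq[OF comp xy, of \<beta>] by (auto simp: F_def)
    next
      case False
      define \<delta> where "\<delta> = \<gamma> * mdist M x y"
      have d: "comp_dist \<beta> M N u v = \<beta> * \<delta>"
        using False comp_dist_eq[OF comp xy, of \<beta>] by (simp add: \<delta>_def \<gamma>_def)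
      have \<gamma>: "\<gamma> > 0" using mdiameter_le_gamma(2)[OF comp xy(1,2) False xy(1)] by (simp add: \<gamma>_def)
      then have \<delta>: "\<delta> \<ge> 0" by (simp add: \<delta>_def)
      have small: "norm (\<psi> z w - \<psi> z (p z)) \<le> s * \<delta>"
        if "z \<in> mspace M" "w \<in> mspace (N z)" for z w
      proof -
        have "norm (\<psi> z w - \<psi> z (p z)) \<le> s * mdist (N z) w (p z)"
          using \<psi> that p by blast
        also have "mdist (N z) w (p z) \<le> mdiameter (N z)"
          using that comp p by (intro mdist_le_mdiameter) (auto simp: composable_def)
        also have "\<dots> \<le> \<delta>"
          using mdiameter_le_gamma(1)[OF comp xy(1,2) False that(1)] by (simp add: \<delta>_def \<gamma>_def)
        finally show ?thesis using s by simp
      qed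
      define n where "n = norm ((\<beta> * \<gamma>) *\<^sub>R \<phi> x - (\<beta> * \<gamma>) *\<^sub>R \<phi> y)"
      have n: "n = \<beta> * \<gamma> * norm (\<phi> x - \<phi> y)"
        using \<beta> \<gamma> by (simp add: n_def flip: scaleR_diff_right)
      have n_lower: "\<beta> * \<delta> \<le> n"
        using mult_left_mono[OF \<phi>(1)[OF xy(1,2)], of "\<beta> * \<gamma>"] \<beta> \<gamma> by (simp add: n \<delta>_def mult_ac)
      have n_upper: "n \<le> C * (\<beta> * \<delta>)"
        using mult_left_mono[OF \<phi>(2)[OF xy(1,2)], of "\<beta> * \<gamma>"] \<beta> \<gamma> by (simp add: n \<delta>_def mult_ac)
      note near = norm_perturbed_diff_bounds[OF small[OF xy(1,3)] small[OF xy(2,4)],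
          of "(\<beta> * \<gamma>) *\<^sub>R \<phi> x" "(\<beta> * \<gamma>) *\<^sub>R \<phi> y", folded F_def n_def f]
      have "L * (\<beta> * \<delta>) \<le> (1 - 2 * s / \<beta>) * (\<beta> * \<delta>)"
        using \<beta> \<delta> by (intro mult_right_mono) (auto simp: L_def)
      also have "\<dots> = \<beta> * \<delta> - 2 * (s * \<delta>)" using \<beta> by (simp add: field_simps)
      finally have lower: "L * (\<beta> * \<delta>) \<le> norm (f u - f v)" using near(1) n_lower by linarith
      have "s * (\<beta> * \<delta>) = (C + 2 * s / \<beta>) * (\<beta> * \<delta>)" by (simp only: s_eq)
      also have "\<dots> = C * (\<beta> * \<delta>) + 2 * (s * \<delta>)" using \<beta> by (simp add: field_simps)
      finally have "norm (f u - f v) \<le> s * (\<beta> * \<delta>)" using near(2) n_upper by linarith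
      with lower show ?thesis by (simp add: d)
    qed
  qed
  then show ?thesis
    unfolding A_def[symmetric] using comp \<beta> L s_le
    by (intro embeddableI_bounds[where f = f and L = L and U = s])
      (auto simp: mspace_composition mdist_composition dist_norm)
qed

theorem theorem2p9:
  fixes C D \<beta> :: real
    and M :: "'a metric" and N :: "'a \<Rightarrow> 'b metric"
  assumes C: "C \<ge> 1" and D: "D \<ge> 1"
    and comp: "composable M N"
    and M_emb: "embeddable C M (euclidean_metric :: ('e::banach) metric)"
    and N_emb: "\<And>x. x \<in> mspace M \<Longrightarrow> embeddable D (N x) (euclidean_metric :: 'e metric)"
    and beta: "\<beta> > 2 * (C + 1)"
  shows "embeddable (max D (C + 2 * C * (C + 1) / (\<beta> - 2 * (C + 1))))
           (composition \<beta> M N) (euclidean_metric :: 'e metric) \<and>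
         (\<forall>\<epsilon>>0. D \<le> C \<and> \<beta> > 2 * ((C + \<epsilon>) / \<epsilon>) * (C + 1) \<longrightarrow>
           embeddable (C + \<epsilon>) (composition \<beta> M N) (euclidean_metric :: 'e metric))"
proof (intro conjI allI impI)
  show *: "embeddable (max D (C + 2 * C * (C + 1) / (\<beta> - 2 * (C + 1))))
      (composition \<beta> M N) (euclidean_metric :: 'e metric)"
    using C D comp M_emb N_emb beta by (rule embeddable_composition)
  fix \<epsilon> :: real
  assume \<epsilon>: "\<epsilon> > 0" and h: "D \<le> C \<and> \<beta> > 2 * ((C + \<epsilon>) / \<epsilon>) * (C + 1)"
  have "2 * C * (C + 1) \<le> \<epsilon> * (\<beta> - 2 * (C + 1))"
    using h \<epsilon> by (simp add: field_simps)
  then have "2 * C * (C + 1) / (\<beta> - 2 * (C + 1)) \<le> \<epsilon>"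
    using beta by (simp add: divide_le_eq)
  then show "embeddable (C + \<epsilon>) (composition \<beta> M N) (euclidean_metric :: 'e metric)"
    using embeddable_mono[OF *] h \<epsilon> by simp
qed

end
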